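(* Let $\varphi(x_1,\dots,x_n)=C_1\land\dots\land C_m$ be a propositional formula in conjunctive normal form with nonempty clauses over the variables $x_1,\dots,x_n$. Let $r$ and $s$ be the (lookaround-free, quantifier-free) JavaScript regex and the string associated with $\varphi$ in the context. Then the result of the instance $\varphi$ of CNF LEXICOGRAPHIC SAT is equal to the transformation, into an assignment of the variables to $\top$ or $\bot$, of the result of matching $r$ on $s$ from the beginning. That is: if $r$ matches $s$ from the beginning with highest-priority result having group map $\gamma$, then the assignment mapping $x_i$ to $\top$ if $\gamma(i)$ is defined and to $\bot$ otherwise ($1\le i\le n$) is the lexicographically maximum satisfying assignment of $\varphi$; and if $r$ does not match $s$ from the beginning, then $\varphi$ is unsatisfiable (result $0$).
   Context: **CNF LEXICOGRAPHIC SAT.** Input: a propositional formula $\varphi(x_1,\dots,x_n)$ in conjunctive normal form. Output: the lexicographically maximum assignment of $x_1,\dots,x_n$ (with $x_1$ most significant and $\top>\bot$) that makes $\varphi$ true, or $0$ if there is none. **Regexes.** Fix an alphabet containing $\mathtt{x}$, $\mathtt{;}$, $\mathtt{z}$. Regexes used here: the empty regex $\varepsilon$; a single character $c$; disjunction $r_1|r_2$; sequence $r_1r_2$; capture group $({}_g\, r)$ with group identifier $g$; backreference $\backslash g$. Brackets $\langle r\rangle$ are non-capturing and only used for parsing. $\backslash g\,\mathtt{x}$ is the sequence of $\backslash g$ and $\mathtt{x}$. **JavaScript backtracking semantics (for these constructs).** Fix a string $s=s_0\cdots s_{|s|-1}$. A group map $\gamma$ assigns to each group identifier either "undefined", "opened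 at $a$", or a closed range $(a,b)$; $\emptyset$ is the everywhere undefined map. An action is a regex or $\mathrm{Aclose}\,g$. For a list of actions $l$, a position $0\le p\le |s|$ and a group map $\gamma$, the ordered list of results (leaves of the backtracking tree, highest priority first) $L(l,p,\gamma)$ is defined by: - $L([],p,\gamma)=[(p,\gamma)]$. - $L(\varepsilon::l,p,\gamma)=L(l,p,\gamma)$. - $L(c::l,p,\gamma)=L(l,p+1,\gamma)$ if $p<|s|$ and $s_p=c$, else $[]$. - $L((r_1|r_2)::l,p,\gamma)=L(r_1::l,p,\gamma)$ concatenated with $L(r_2::l,p,\gamma)$ (in this order). - $L(r_1r_2::l,p,\gamma)=L(r_1::r_2::l,p,\gamma)$. - $L(({}_g\,r)::l,p,\gamma)=L(r::\mathrm{Aclose}\,g::l,p,\gamma[g\mapsto\text{opened at }p])$. - $L(\mathrm{Aclose}\,g::l,p,\gamma)=L(l,p,\gamma[g\mapsto(a,p)])$ where $g$ is opened at $a$ in $\gamma$. - $L(\backslash g::l,p,\gamma)$: if $\gamma(g)$ is not a closed range, it is $L(l,p,\gamma)$; if $\gamma(g)=(a,b)$ and $w=s_a\cdots s_{b-1}$, it is $L(l,p+|w|,\gamma)$ if $w$ occurs in $s$ at position $p$, else $[]$. The regex $r$ *matches $s$ from the beginning* if $L([r],0,\emptyset)\ne[]$; its highest-priority result is then the first element of that list. **Construction.** Group identifiers are $1,\dots,n$. Write $C_j=l_{j,1}\lor\dots\lor l_{j,v_j}$ with $v_j\ge1$. An empty concatenation of regexes is $\varepsilon$. - $R_{\mathrm{lit}}(x_i)=\backslash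 i$ and $R_{\mathrm{lit}}(\neg x_i)=\backslash i\,\mathtt{x}$. - $R_{\mathrm{cl}}(C_j)=\langle R_{\mathrm{lit}}(l_{j,1})|\cdots|R_{\mathrm{lit}}(l_{j,v_j})\rangle\,\mathtt{;}$ - $E(x_i)=\langle({}_i\,\mathtt{x})|\mathtt{x}\rangle\,\mathtt{;}$ - $r=E(x_1)E(x_2)\cdots E(x_n)R_{\mathrm{cl}}(C_1)\cdots R_{\mathrm{cl}}(C_m)$. - $s$ is the string consisting of $n+m$ copies of $\mathtt{x;}$ followed by $\mathtt{z}$. *)

theory Defs
  imports Main "HOL-Library.List_Lexorder"
begin

section \<open>CNF lexicographic SAT\<close>

datatype literal = Pos nat | Neg nat

type_synonym clause = "literal list"
type_synonym cnf = "clause list"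

fun var :: "literal \<Rightarrow> nat" where
  "var (Pos i) = i"
| "var (Neg i) = i"

definition cnf_over :: "nat \<Rightarrow> cnf \<Rightarrow> bool" where
  "cnf_over n \<phi> \<longleftrightarrow> (\<forall>C \<in> set \<phi>. C \<noteq> [] \<and> (\<forall>l \<in> set C. var l \<in> {1..n}))"

text \<open>An assignment of \<open>x\<^sub>1, \<dots>, x\<^sub>n\<close> is a list of \<open>n\<close> truth values. Variables are numbered
  from 1, list positions from 0, so the value of \<open>x\<^sub>i\<close> is at position \<open>i - 1\<close>.\<close>

fun lit_true :: "bool list \<Rightarrow> literal \<Rightarrow> bool" where
  "lit_true \<alpha> (Pos i) \<longleftrightarrow> \<alpha> ! (i - 1)"
| "lit_true \<alpha> (Neg i) \<longleftrightarrow> \<not> \<alpha> ! (i - 1)"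

definition satisfies :: "bool list \<Rightarrow> cnf \<Rightarrow> bool" where
  "satisfies \<alpha> \<phi> \<longleftrightarrow> (\<forall>C \<in> set \<phi>. \<exists>l \<in> set C. lit_true \<alpha> l)"

definition sat_assignments :: "nat \<Rightarrow> cnf \<Rightarrow> bool list set" where
  "sat_assignments n \<phi> = {\<alpha>. length \<alpha> = n \<and> satisfies \<alpha> \<phi>}"

text \<open>\<open>Max\<close> refers to the lexicographic order on \<open>bool list\<close>, in which the first element is the
  most significant and \<open>False < True\<close>. The result \<open>0\<close> is rendered as \<open>None\<close>.\<close>

definition cnf_lex_sat :: "nat \<Rightarrow> cnf \<Rightarrow> bool list option" where
  "cnf_lex_sat n \<phi> =
     (if sat_assignments n \<phi> = {} then None else Some (Max (sat_assignments n \<phi>)))"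


section \<open>Regexes and their backtracking semantics\<close>

datatype 'c regex =
    Eps
  | Chr 'c
  | Disj "'c regex" "'c regex"
  | Sequ "'c regex" "'c regex"
  | Group nat "'c regex"
  | Backref nat

datatype 'c action = Areg "'c regex" | Aclose nat

text \<open>Undefined groups are those outside the domain of the map.\<close>

datatype group_state = Opened nat | Closed nat nat

type_synonym group_map = "nat \<rightharpoonup> group_state"

definition substr :: "'c list \<Rightarrow> nat \<Rightarrow> nat \<Rightarrow> 'c list" where
  "substr s a b = take (b - a) (drop a s)"

definition occurs_at :: "'c list \<Rightarrow> 'c list \<Rightarrow> nat \<Rightarrow> bool" where
  "occurs_at w s p \<longleftrightarrow> p + length w \<le> length s \<and> substr s p (p + length w) = w"

primrec regex_weight :: "'c regex \<Rightarrow> nat" where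
  "regex_weight Eps = 1"
| "regex_weight (Chr c) = 1"
| "regex_weight (Disj r1 r2) = regex_weight r1 + regex_weight r2 + 1"
| "regex_weight (Sequ r1 r2) = regex_weight r1 + regex_weight r2 + 1"
| "regex_weight (Group g r) = regex_weight r + 2"
| "regex_weight (Backref g) = 1"

primrec action_weight :: "'c action \<Rightarrow> nat" where
  "action_weight (Areg r) = regex_weight r"
| "action_weight (Aclose g) = 1"

text \<open>Closing a group that is not open does not happen in runs from the empty group map on
  a regex in which no group is nested inside a group with the same identifier; the value \<open>[]\<close> is
  a dummy for this case.\<close>

function results :: "'c list \<Rightarrow> 'c action list \<Rightarrow> nat \<Rightarrow> group_map \<Rightarrow> (nat \<times> group_map) list" where
  "results s [] p \<gamma> = [(p, \<gamma>)]"
| "results s (Areg Eps # l) p \<gamma> = results s l p \<gamma>"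
| "results s (Areg (Chr c) # l) p \<gamma> =
     (if p < length s \<and> s ! p = c then results s l (p + 1) \<gamma> else [])"
| "results s (Areg (Disj r1 r2) # l) p \<gamma> =
     results s (Areg r1 # l) p \<gamma> @ results s (Areg r2 # l) p \<gamma>"
| "results s (Areg (Sequ r1 r2) # l) p \<gamma> = results s (Areg r1 # Areg r2 # l) p \<gamma>"
| "results s (Areg (Group g r) # l) p \<gamma> =
     results s (Areg r # Aclose g # l) p (\<gamma>(g \<mapsto> Opened p))"
| "results s (Aclose g # l) p \<gamma> =
     (case \<gamma> g of
        Some (Opened a) \<Rightarrow> results s l p (\<gamma>(g \<mapsto> Closed a p))
      | _ \<Rightarrow> [])"
| "results s (Areg (Backref g) # l) p \<gamma> =
     (case \<gamma> g of
        Some (Closed a b) \<Rightarrow>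
          (let w = substr s a b
           in if occurs_at w s p then results s l (p + length w) \<gamma> else [])
      | _ \<Rightarrow> results s l p \<gamma>)"
  by pat_completeness auto

lemma regex_weight_pos: "0 < regex_weight r"
  by (induction r) auto

termination results
  by (relation "measure (\<lambda>(s, l, p, \<gamma>). sum_list (map action_weight l))")
    (auto simp: regex_weight_pos)

definition match_from_beginning :: "'c regex \<Rightarrow> 'c list \<Rightarrow> (nat \<times> group_map) option" where
  "match_from_beginning r s =
     (case results s [Areg r] 0 Map.empty of [] \<Rightarrow> None | res # _ \<Rightarrow> Some res)"


section \<open>The regex and the string associated with a formula\<close>

fun sequence :: "'c regex list \<Rightarrow> 'c regex" where
  "sequence [] = Eps"
| "sequence [r] = r"
| "sequence (r # rs) = Sequ r (sequence rs)"

text \<open>Only applied to nonempty lists.\<close>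

fun disjunction :: "'c regex list \<Rightarrow> 'c regex" where
  "disjunction [] = undefined"
| "disjunction [r] = r"
| "disjunction (r # rs) = Disj r (disjunction rs)"

text \<open>The alphabet is an arbitrary type; its characters \<open>x\<close>, \<open>;\<close> and \<open>z\<close> are the parameters
  \<open>cx\<close>, \<open>cs\<close> and \<open>cz\<close>.\<close>

fun R_lit :: "'c \<Rightarrow> literal \<Rightarrow> 'c regex" where
  "R_lit cx (Pos i) = Backref i"
| "R_lit cx (Neg i) = Sequ (Backref i) (Chr cx)"

definition R_cl :: "'c \<Rightarrow> 'c \<Rightarrow> clause \<Rightarrow> 'c regex" where
  "R_cl cx cs C = Sequ (disjunction (map (R_lit cx) C)) (Chr cs)"

definition R_var :: "'c \<Rightarrow> 'c \<Rightarrow> nat \<Rightarrow> 'c regex" where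
  "R_var cx cs i = Sequ (Disj (Group i (Chr cx)) (Chr cx)) (Chr cs)"

definition cnf_regex :: "'c \<Rightarrow> 'c \<Rightarrow> nat \<Rightarrow> cnf \<Rightarrow> 'c regex" where
  "cnf_regex cx cs n \<phi> = sequence (map (R_var cx cs) [1..<n + 1] @ map (R_cl cx cs) \<phi>)"

definition cnf_string :: "'c \<Rightarrow> 'c \<Rightarrow> 'c \<Rightarrow> nat \<Rightarrow> cnf \<Rightarrow> 'c list" where
  "cnf_string cx cs cz n \<phi> = concat (replicate (n + length \<phi>) [cx, cs]) @ [cz]"

definition decode_assignment :: "nat \<Rightarrow> group_map \<Rightarrow> bool list" where
  "decode_assignment n \<gamma> = map (\<lambda>i. \<gamma> i \<noteq> None) [1..<n + 1]"

end

(* After the groups E(x_1), ..., E(x_n) are processed the group map encodes an assignment alpha: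
   group i holds the string "x" if x_i is true and is undefined otherwise. The backtracking order
   runs through the assignments in decreasing lexicographic order, since the branch that sets a
   group has the higher priority. Under alpha, the regex of a literal followed by ";" consumes one
   block "x;" if the literal is true, and fails otherwise: a false positive literal consumes nothing
   before ";", and a false negative literal requires "xx". So the leaves below alpha exist iff
   alpha satisfies the formula, they do not change the group map, and the first leaf overall belongs
   to the largest satisfying assignment. *)
theory Submission
  imports Defs
begin

section \<open>Results for lists of actions\<close>

text \<open>Every equation of \<open>results\<close> acts on the head of the list and leaves the
  tail alone, so \<open>L\<close> resumes from each leaf of \<open>A\<close> in order.\<close>

lemma results_append:
  "results s (A @ L) p \<gamma> = concat (map (\<lambda>(q, \<delta>). results s L q \<delta>) (results s A p \<gamma>))"
  by (induction s A p \<gamma> rule: results.induct)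
    (auto simp: Let_def fun_upd_def split: option.splits group_state.splits)

lemma results_sequence:
  "results s (Areg (sequence rs) # L) p \<gamma> = results s (map Areg rs @ L) p \<gamma>"
proof (induction rs arbitrary: p \<gamma> rule: sequence.induct)
  case (3 r r' rs)
  then show ?case
    \<comment> \<open>Splitting off \<open>r\<close> on both sides exposes its leaves; the induction
      hypothesis applies at each of them.\<close>
    using results_append[of s "[Areg r]" "Areg (sequence (r' # rs)) # L" p \<gamma>]
      results_append[of s "[Areg r]" "map Areg (r' # rs) @ L" p \<gamma>]
    by simp
qed simp_all

lemma results_disjunction:
  "rs \<noteq> [] \<Longrightarrow> results s (Areg (disjunction rs) # L) p \<gamma> =
     concat (map (\<lambda>r. results s (Areg r # L) p \<gamma>) rs)"
  by (induction rs rule: disjunction.induct) auto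

section \<open>Blocks and encoded assignments\<close>

lemma length_blocks: "length (concat (replicate N [a, b])) = 2 * N"
  by (induction N) auto

lemma nth_blocks:
  assumes "k < N"
  shows "concat (replicate N [a, b]) ! (2 * k) = a"
    and "concat (replicate N [a, b]) ! Suc (2 * k) = b"
  using assms
proof (induction N arbitrary: k)
  case (Suc N)
  { case 1 then show ?case using Suc by (cases k) auto }
  { case 2 then show ?case using Suc by (cases k) auto }
qed auto

text \<open>Variable \<open>i\<close> is read in block \<open>i - 1\<close>, whose \<open>x\<close>
  starts at \<open>2 * (i - 1)\<close>. A shorter list encodes a partial assignment of the first
  variables.\<close>

definition assignment_groups :: "bool list \<Rightarrow> group_map" where
  "assignment_groups \<alpha> = (\<lambda>i. if i \<in> {1..length \<alpha>} \<and> \<alpha> ! (i - 1)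
     then Some (Closed (2 * (i - 1)) (Suc (2 * (i - 1)))) else None)"

lemma assignment_groups_Nil: "assignment_groups [] = Map.empty"
  by (auto simp: assignment_groups_def)

lemma assignment_groups_snoc_False:
  "assignment_groups (\<alpha> @ [False]) = assignment_groups \<alpha>"
  by (auto simp: assignment_groups_def nth_append fun_eq_iff)

lemma assignment_groups_snoc_True:
  "assignment_groups (\<alpha> @ [True]) =
     (assignment_groups \<alpha>)(Suc (length \<alpha>) \<mapsto> Closed (2 * length \<alpha>) (Suc (2 * length \<alpha>)))"
  by (auto simp: assignment_groups_def nth_append fun_eq_iff)

lemma decode_assignment_groups:
  "decode_assignment (length \<alpha>) (assignment_groups \<alpha>) = \<alpha>"
  by (auto simp: decode_assignment_def assignment_groups_def intro!: nth_equalityI simp del: upt_Suc)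

section \<open>Enumeration of assignments in decreasing order\<close>

text \<open>Listing \<open>True\<close> before \<open>False\<close> reproduces the order in which
  backtracking tries the capturing branch first.\<close>

definition descending_assignments :: "nat \<Rightarrow> bool list list" where
  "descending_assignments n = product_lists (replicate n [True, False])"

lemma descending_assignments_simps:
  "descending_assignments 0 = [[]]"
  "descending_assignments (Suc n) =
     map ((#) True) (descending_assignments n) @ map ((#) False) (descending_assignments n)"
  by (simp_all add: descending_assignments_def)

lemma set_descending_assignments: "set (descending_assignments n) = {\<alpha>. length \<alpha> = n}"
proof (induction n)
  case (Suc n)
  have "\<alpha> \<in> (#) True ` {\<alpha>. length \<alpha> = n} \<union> (#) False ` {\<alpha>. length \<alpha> = n} \<longleftrightarrow> length \<alpha> = Suc n" for \<alpha>
    by (cases \<alpha>) (auto simp: image_iff)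
  with Suc show ?case by (auto simp: descending_assignments_simps)
qed (simp add: descending_assignments_simps)

lemma sorted_descending_assignments: "sorted_wrt (>) (descending_assignments n)"
  by (induction n) (auto simp: descending_assignments_simps sorted_wrt_append sorted_wrt_map)

text \<open>All later elements are smaller, so a hit at the head is the maximum, and a miss drops
  out of the set.\<close>

lemma find_sorted_greater:
  fixes xs :: "'a :: linorder list"
  assumes "sorted_wrt (>) xs"
  shows "find P xs = (if {x \<in> set xs. P x} = {} then None else Some (Max {x \<in> set xs. P x}))"
  using assms
proof (induction xs)
  case (Cons x xs)
  show ?case
  proof (cases "P x")
    case True
    then have "Max {y \<in> set (x # xs). P y} = x"
      using Cons.prems by (intro Max_eqI) auto
    with True show ?thesis by auto
  next
    case False
    then have "{y \<in> set (x # xs). P y} = {y \<in> set xs. P y}" by auto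
    with False Cons show ?thesis by simp
  qed
qed simp

lemma cnf_lex_sat_eq_find:
  "cnf_lex_sat n \<phi> = find (\<lambda>\<alpha>. satisfies \<alpha> \<phi>) (descending_assignments n)"
  by (simp add: find_sorted_greater sorted_descending_assignments set_descending_assignments
    cnf_lex_sat_def sat_assignments_def)

text \<open>The hypothesis speaks of sets because one assignment may have several equal leaves, one
  for each choice of true literals.\<close>

lemma first_of_concat:
  assumes "\<And>x. x \<in> set xs \<Longrightarrow> set (f x) = (if P x then {g x} else {})"
  shows "(case concat (map f xs) of [] \<Rightarrow> None | y # _ \<Rightarrow> Some y) = map_option g (find P xs)"
  using assms
proof (induction xs)
  case (Cons x xs)
  then have "set (f x) = (if P x then {g x} else {})" by simp
  with Cons show ?case by (cases "f x") (auto split: if_splits)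
qed simp

lemma cnf_lex_sat_None: "cnf_lex_sat n \<phi> = None \<longleftrightarrow> sat_assignments n \<phi> = {}"
  by (simp add: cnf_lex_sat_def)

lemma cnf_lex_sat_Some:
  assumes "cnf_lex_sat n \<phi> = Some \<alpha>"
  shows "\<alpha> \<in> sat_assignments n \<phi>" "\<And>\<beta>. \<beta> \<in> sat_assignments n \<phi> \<Longrightarrow> \<beta> \<le> \<alpha>"
proof -
  have fin: "finite (sat_assignments n \<phi>)"
    by (rule finite_subset[OF _ finite_set[of "descending_assignments n"]])
      (auto simp: sat_assignments_def set_descending_assignments)
  have "sat_assignments n \<phi> \<noteq> {}" "\<alpha> = Max (sat_assignments n \<phi>)"
    using assms by (auto simp: cnf_lex_sat_def split: if_splits)
  with fin show "\<alpha> \<in> sat_assignments n \<phi>" "\<And>\<beta>. \<beta> \<in> sat_assignments n \<phi> \<Longrightarrow> \<beta> \<le> \<alpha>"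
    by auto
qed

section \<open>Matching on a string of blocks\<close>

locale block_string =
  fixes cx cs cz :: 'c and N :: nat and s :: "'c list"
  assumes cx_neq_cs: "cx \<noteq> cs"
  defines s_def: "s \<equiv> concat (replicate N [cx, cs]) @ [cz]"
begin

lemma length_s: "length s = Suc (2 * N)"
  by (simp add: s_def length_blocks)

lemma nth_s:
  assumes "k < N"
  shows "s ! (2 * k) = cx" "s ! Suc (2 * k) = cs"
  using assms by (auto simp: s_def nth_append length_blocks nth_blocks)

lemma substr_s: "k < N \<Longrightarrow> substr s (2 * k) (Suc (2 * k)) = [cx]"
  by (simp add: substr_def take_Suc_conv_app_nth length_s nth_s)

text \<open>Both branches consume the same block and differ only in group \<open>i\<close>.\<close>

lemma results_R_var:
  assumes "k < N"
  shows "results s (Areg (R_var cx cs i) # L) (2 * k) \<gamma> =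
     results s L (2 * Suc k) (\<gamma>(i \<mapsto> Closed (2 * k) (Suc (2 * k)))) @ results s L (2 * Suc k) \<gamma>"
  using assms by (simp add: R_var_def length_s nth_s)

text \<open>Starting from an arbitrary decided prefix \<open>\<alpha>\<close> permits induction on
  the number \<open>k\<close> of remaining variables.\<close>

lemma results_R_vars:
  assumes "length \<alpha> + k \<le> N"
  shows "results s (map (\<lambda>i. Areg (R_var cx cs i)) [Suc (length \<alpha>)..<Suc (length \<alpha> + k)] @ L)
       (2 * length \<alpha>) (assignment_groups \<alpha>) =
     concat (map (\<lambda>\<beta>. results s L (2 * (length \<alpha> + k)) (assignment_groups (\<alpha> @ \<beta>)))
       (descending_assignments k))"
  using assms
proof (induction k arbitrary: \<alpha>)
  case 0
  then show ?case by (simp add: descending_assignments_simps)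
next
  case (Suc k)
  \<comment> \<open>The interval is split at its front, since the variable decided next extends the
    prefix.\<close>
  have upt: "[Suc (length \<alpha>)..<Suc (length \<alpha> + Suc k)] =
      Suc (length \<alpha>) # [Suc (Suc (length \<alpha>))..<Suc (Suc (length \<alpha>) + k)]"
    by (subst upt_conv_Cons) auto
  show ?case
    using Suc.prems Suc.IH[of "\<alpha> @ [True]"] Suc.IH[of "\<alpha> @ [False]"]
    unfolding upt
    by (simp add: results_R_var fun_upd_def assignment_groups_snoc_True assignment_groups_snoc_False
      descending_assignments_simps comp_def del: upt_Suc mult_Suc_right)
qed

text \<open>Failure rests on \<open>cx \<noteq> cs\<close>: a false positive literal leaves
  \<open>;\<close> facing \<open>cx\<close>, a false negative one leaves its extra \<open>x\<close>
  facing \<open>cs\<close>.\<close>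

lemma results_R_lit:
  assumes "k < N" "length \<alpha> \<le> N" "var l \<in> {1..length \<alpha>}"
  shows "results s (Areg (R_lit cx l) # Areg (Chr cs) # L) (2 * k) (assignment_groups \<alpha>) =
    (if lit_true \<alpha> l then results s L (2 * Suc k) (assignment_groups \<alpha>) else [])"
proof (cases l)
  case (Pos i)
  then have "substr s (2 * (i - 1)) (Suc (2 * (i - 1))) = [cx]"
    using assms by (intro substr_s) auto
  then show ?thesis
    using assms Pos cx_neq_cs
    by (simp add: assignment_groups_def occurs_at_def Let_def length_s nth_s substr_s)
next
  case (Neg i)
  then have "substr s (2 * (i - 1)) (Suc (2 * (i - 1))) = [cx]"
    using assms by (intro substr_s) auto
  then show ?thesis
    using assms Neg cx_neq_cs
    by (simp add: assignment_groups_def occurs_at_def Let_def length_s nth_s substr_s)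
qed

text \<open>Each true literal contributes a copy of the same leaves; passing to sets merges the
  copies.\<close>

lemma set_results_R_cl:
  assumes "k < N" "length \<alpha> \<le> N" "C \<noteq> []" "\<forall>l\<in>set C. var l \<in> {1..length \<alpha>}"
  shows "set (results s (Areg (R_cl cx cs C) # L) (2 * k) (assignment_groups \<alpha>)) =
    (if \<exists>l\<in>set C. lit_true \<alpha> l then set (results s L (2 * Suc k) (assignment_groups \<alpha>)) else {})"
  using assms
  by (auto simp: R_cl_def results_disjunction results_R_lit simp del: mult_Suc_right split: if_splits)

lemma set_results_R_cls:
  assumes "k + length \<phi> \<le> N" "length \<alpha> \<le> N" "cnf_over (length \<alpha>) \<phi>"
  shows "set (results s (map (\<lambda>C. Areg (R_cl cx cs C)) \<phi>) (2 * k) (assignment_groups \<alpha>)) =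
    (if satisfies \<alpha> \<phi> then {(2 * (k + length \<phi>), assignment_groups \<alpha>)} else {})"
  using assms
proof (induction \<phi> arbitrary: k)
  case Nil
  then show ?case by (simp add: satisfies_def)
next
  case (Cons C \<phi>)
  then show ?case
    using Cons.IH[of "Suc k"]
    by (simp add: set_results_R_cl cnf_over_def satisfies_def del: mult_Suc_right)
qed

end

theorem theorem7:
  fixes cx cs cz :: 'c and n :: nat and \<phi> :: cnf
  assumes "distinct [cx, cs, cz]"
    and "cnf_over n \<phi>"
  defines "r \<equiv> cnf_regex cx cs n \<phi>"
    and "s \<equiv> cnf_string cx cs cz n \<phi>"
  shows "cnf_lex_sat n \<phi> =
           map_option (\<lambda>(p, \<gamma>). decode_assignment n \<gamma>) (match_from_beginning r s)
    \<and> (\<forall>p \<gamma>. match_from_beginning r s = Some (p, \<gamma>) \<longrightarrow>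
           decode_assignment n \<gamma> \<in> sat_assignments n \<phi>
           \<and> (\<forall>\<alpha> \<in> sat_assignments n \<phi>. \<alpha> \<le> decode_assignment n \<gamma>))
    \<and> (match_from_beginning r s = None \<longrightarrow> sat_assignments n \<phi> = {})"
proof -
  define N where "N = n + length \<phi>"
  interpret block_string cx cs cz N s
    using assms(1) by unfold_locales (simp_all add: s_def cnf_string_def N_def)
  \<comment> \<open>The subtree below a full assignment: the variables have consumed
    \<open>n\<close> blocks, so the clauses start at \<open>2 * n\<close>.\<close>
  define leaves where "leaves = (\<lambda>\<alpha>. results s (map (\<lambda>C. Areg (R_cl cx cs C)) \<phi>) (2 * n)
    (assignment_groups \<alpha>))"
  have "results s [Areg r] 0 Map.empty = concat (map leaves (descending_assignments n))"
    using results_sequence[of s "map (R_var cx cs) [1..<n + 1] @ map (R_cl cx cs) \<phi>" "[]"]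
      \<comment> \<open>The empty prefix corresponds to the empty group map at position 0.\<close>
      results_R_vars[of "[]" n "map (\<lambda>C. Areg (R_cl cx cs C)) \<phi>"]
    by (simp add: r_def cnf_regex_def leaves_def assignment_groups_Nil comp_def N_def del: upt_Suc)
  moreover have "set (leaves \<alpha>) = (if satisfies \<alpha> \<phi> then {(2 * N, assignment_groups \<alpha>)} else {})"
    if "\<alpha> \<in> set (descending_assignments n)" for \<alpha>
    using that assms(2) set_results_R_cls[of n \<phi> \<alpha>]
    by (auto simp: leaves_def N_def set_descending_assignments)
  ultimately have match: "match_from_beginning r s =
      map_option (\<lambda>\<alpha>. (2 * N, assignment_groups \<alpha>)) (cnf_lex_sat n \<phi>)"
    by (simp add: match_from_beginning_def cnf_lex_sat_eq_find first_of_concat)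
  have decode: "decode_assignment n (assignment_groups \<alpha>) = \<alpha>" if "cnf_lex_sat n \<phi> = Some \<alpha>" for \<alpha>
    using cnf_lex_sat_Some(1)[OF that] decode_assignment_groups[of \<alpha>]
    by (auto simp: sat_assignments_def)
  show ?thesis
  proof (cases "cnf_lex_sat n \<phi>")
    case None
    with match show ?thesis by (simp add: cnf_lex_sat_None[symmetric])
  next
    case (Some \<alpha>)
    with match decode cnf_lex_sat_Some[OF Some] show ?thesis by auto
  qed
qed

end
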